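(* Let $n$ be a positive integer, $q=2^n$, and $d=q^3+q^2+q-1$. For $b\in\mathbb{F}_{q^4}$, the number of solutions $x\in\mathbb{F}_{q^4}$ of the equation $x^d+(x+1)^d=b$ is equal to $q^2$ if $b=1$; $q^2-q$ if $b\in\mu_{q+1}\setminus\{1\}$; $2$ if $b\in\Lambda$; and $0$ otherwise, where $$\Lambda=\left\{c\in\mathbb{F}_{q^4}^*:\ \mathfrak{t}'\neq 0\ \text{and}\ \mathbf{Tr}_2^{q}\!\left(\frac{\mathfrak{n}'^{\frac{q+1}{2}}}{\mathfrak{t}'}\right)=1\right\},$$ with, for $c\in\mathbb{F}_{q^4}^*$, $\mathfrak{t}=\mathbf{Tr}_{q^2}^{q^4}(c)=c+c^{q^2}$, $\mathfrak{n}=\mathbf{N}_{q^2}^{q^4}(c)=c^{q^2+1}$, $\mathfrak{t}'=\mathfrak{t}+\mathfrak{t}^q$, $\mathfrak{n}'=\mathfrak{n}+1$. Furthermore, the differential spectrum of the power function $F(x)=x^d$ over $\mathbb{F}_{q^4}$ is $$\mathbb{S}=\{w_0=(\tfrac{1}{2}q^3-1)(q+1),\ w_2=\tfrac{1}{2}q^3(q-1),\ w_{q^2}=1,\ w_{q^2-q}=q\}.$$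
   Context: For a positive integer $s$ dividing $q^4-1$, $\mu_s=\{x\in\mathbb{F}_{q^4}^*: x^s=1\}$. For a prime power $r$ and $m\ge1$, $\mathbf{Tr}_r^{r^m}(x)=\sum_{i=0}^{m-1}x^{r^i}$ and $\mathbf{N}_r^{r^m}(x)=\prod_{i=0}^{m-1}x^{r^i}$. Since $q^4-1$ is odd, exponents with a power of $2$ in the denominator (such as $\frac{q+1}{2}$) are interpreted modulo $q^4-1$ where $2$ is invertible; e.g. $y^{1/2}$ is the unique square root of $y$ in $\mathbb{F}_{q^4}$. For $F(x)=x^d$, $\delta_F(1,b)=|\{x\in\mathbb{F}_{q^4}: F(x+1)+F(x)=b\}|$, $w_i=|\{b\in\mathbb{F}_{q^4}:\delta_F(1,b)=i\}|$, and the differential spectrum is the set of the values $w_i$ for even $i$ with $0\le i\le \max_b\delta_F(1,b)$ (listed with their indices).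
   Formalization: For n=1 (q=2) the indices 2 and q^2-q coincide, so the printed spectrum gives w_2 two different values; there the two entries are added, w_2 = q^3(q-1)/2 + q = 6. For n≥2 the spectrum is as printed, with all other even-index w_i stated to be 0. *)

theory Defs
  imports Complex_Main "HOL-Library.Cardinality"
begin

definition mu :: "nat \<Rightarrow> 'a::field set" where
  "mu s = {x. x \<noteq> 0 \<and> x ^ s = 1}"

text \<open>Relative trace and norm from the field with \<open>r ^ m\<close> elements to the one with \<open>r\<close>
  elements; both fields are viewed inside the ambient field \<open>'a\<close>.\<close>

definition rel_trace :: "nat \<Rightarrow> nat \<Rightarrow> 'a::field \<Rightarrow> 'a" where
  "rel_trace r m x = (\<Sum>i<m. x ^ (r ^ i))"

definition rel_norm :: "nat \<Rightarrow> nat \<Rightarrow> 'a::field \<Rightarrow> 'a" where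
  "rel_norm r m x = (\<Prod>i<m. x ^ (r ^ i))"

text \<open>\<open>half_power x k\<close> is \<open>x\<close> to the power \<open>k / 2\<close>: the square root of \<open>x ^ k\<close>, which exists
  and is unique in a finite field of characteristic two.\<close>

definition half_power :: "'a::field \<Rightarrow> nat \<Rightarrow> 'a" where
  "half_power x k = (THE y. y ^ 2 = x ^ k)"

lemma ex1_square_root_char_2:
  fixes x :: "'a::{field,finite}"
  assumes "(2::'a) = 0"
  shows "\<exists>!y. y ^ 2 = x"
proof -
  have "inj (\<lambda>y::'a. y ^ 2)"
  proof (rule injI)
    fix y z :: 'a
    assume "y ^ 2 = z ^ 2"
    have "(y - z) ^ 2 = y ^ 2 + z ^ 2 - 2 * (y * z)"
      by (simp add: power2_eq_square algebra_simps)
    also have "\<dots> = 2 * z ^ 2 - 2 * (y * z)"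
      using \<open>y ^ 2 = z ^ 2\<close> by (simp only: mult_2)
    finally show "y = z" using assms by simp
  qed
  then have "bij (\<lambda>y::'a. y ^ 2)"
    by (simp add: bij_def finite_UNIV_inj_surj)
  then show ?thesis by (metis bij_pointE)
qed

definition Lambda :: "nat \<Rightarrow> 'a::field set" where
  "Lambda n = {c. c \<noteq> 0 \<and>
     (let q = 2 ^ n;
          t = rel_trace (q ^ 2) 2 c;
          m = rel_norm (q ^ 2) 2 c;
          t' = t + t ^ q;
          m' = m + 1
      in t' \<noteq> 0 \<and> rel_trace 2 n (half_power m' (q + 1) / t') = 1)}"

definition diff_count :: "('a::field \<Rightarrow> 'a) \<Rightarrow> 'a \<Rightarrow> 'a \<Rightarrow> nat" where
  "diff_count F a b = card {x. F (x + a) + F x = b}"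

definition diff_w :: "('a::field \<Rightarrow> 'a) \<Rightarrow> nat \<Rightarrow> nat" where
  "diff_w F i = card {b. diff_count F 1 b = i}"

text \<open>The values of \<open>diff_w\<close> are paired with their indices; indices with value zero are kept.\<close>

definition diff_spectrum :: "('a::{field,finite} \<Rightarrow> 'a) \<Rightarrow> (nat \<times> nat) set" where
  "diff_spectrum F = {(i, diff_w F i) | i. even i \<and> i \<le> Max (range (diff_count F 1))}"

end

theory Submission
  imports Defs "HOL-Computational_Algebra.Polynomial"
begin

text \<open>
  Write \<open>\<sigma>\<close> for \<open>x \<mapsto> x ^ q\<close> (\<open>cj\<close> below), \<open>y = \<sigma>\<^sup>2 x\<close>, and \<open>U\<close> for the group of \<open>e\<close> with \<open>e * \<sigma> e = 1\<close>.
  There is \<open>e \<in> U\<close> with \<open>e * x * y\<close> in the field \<open>F\<^sub>q\<close>, and then \<open>x ^ d = N x / x\<^sup>2 = (e * y)\<^sup>2\<close>.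
  With \<open>f\<close> playing the same role for \<open>x + 1\<close> and \<open>b = \<beta>\<^sup>2\<close>, the equation becomes linear in \<open>y\<close>:
  \<open>\<beta> = (e + f) * y + f\<close>.

  If \<open>\<beta>\<close> lies in the field with \<open>q\<^sup>2\<close> elements and \<open>x\<close> does not, then \<open>e = f = \<beta>\<close>, and the solutions
  are counted through the Artin--Schreier equation satisfied by \<open>x / (x + y)\<close>.
  Otherwise \<open>e \<noteq> f\<close> determine \<open>x\<close>, and with \<open>\<nu> = \<beta> * \<sigma>\<^sup>2 \<beta>\<close>, \<open>\<tau> = \<beta> + \<sigma>\<^sup>2 \<beta>\<close> the conditions on \<open>e\<close> and \<open>f\<close>
  say exactly that both are roots in \<open>U\<close> of \<open>\<sigma> (\<nu> + 1) * Z\<^sup>2 + (\<tau> + \<sigma> \<tau>) * Z + (\<nu> + 1)\<close>. Two distinct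
  such roots exist if and only if the trace condition defining \<open>\<Lambda>\<close> holds, and the two orderings
  of the roots give the solutions \<open>x\<close> and \<open>x + 1\<close>. The size of \<open>\<Lambda>\<close> follows by counting all \<open>x\<close>.
\<close>

subsection \<open>Finite fields\<close>

text \<open>Multiplication by a nonzero \<open>x\<close> permutes the nonzero elements, so it leaves
  their product unchanged.\<close>

lemma power_card_eq_same:
  fixes x :: "'a::{field,finite}"
  shows "x ^ CARD('a) = x"
proof (cases "x = 0")
  case False
  have "x ^ (CARD('a) - 1) * \<Prod>(UNIV - {0}) = (\<Prod>y\<in>UNIV - {0}. x * y)"
    by (simp add: prod.distrib)
  also have "\<dots> = \<Prod>(UNIV - {0})"
    by (rule prod.reindex_bij_witness[of _ "\<lambda>y. y / x" "\<lambda>y. x * y"]) (use False in auto)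
  finally have "x ^ (CARD('a) - 1) = 1"
    by simp
  then have "x ^ Suc (CARD('a) - 1) = x"
    by (simp only: power_Suc mult_1_right)
  then show ?thesis
    by simp
qed simp

text \<open>Translation by 1 permutes the field and changes the sum of all elements by exactly this
  number. Characteristic two is derived from it.\<close>

lemma of_nat_card_eq_0: "of_nat CARD('a) = (0 :: 'a::{field,finite})"
proof -
  have "(\<Sum>x\<in>UNIV. x + 1) = (\<Sum>x\<in>UNIV. x :: 'a)"
    by (rule sum.reindex_bij_witness[of _ "\<lambda>y. y - 1" "\<lambda>y. y + 1"]) auto
  then show ?thesis
    by (simp add: sum.distrib)
qed

text \<open>The polynomial \<open>X ^ (k * m) - 1\<close> is the product of \<open>?f\<close> and
  \<open>?g\<close>. Every nonzero element is a root of one of the factors, so the degree bound on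
  the roots of \<open>?g\<close> leaves at least \<open>k\<close> roots for \<open>?f\<close>; its
  own degree allows no more.\<close>

lemma card_power_eq_1:
  assumes "k * m = CARD('a::{field,finite}) - 1"
  shows "card {x::'a. x ^ k = 1} = k"
proof -
  have "CARD('a) \<ge> card {0, 1 :: 'a}"
    by (rule card_mono) auto
  then have pos: "k > 0" "m > 0"
    using assms by (auto intro: Nat.gr0I)
  let ?f = "monom 1 k - 1 :: 'a poly"
  let ?g = "\<Sum>i<m. monom 1 (k * i) :: 'a poly"
  have f: "coeff ?f k = 1" "degree ?f \<le> k"
    using pos by (auto intro!: degree_diff_le simp: degree_monom_le)
  have "coeff ?g 0 = (\<Sum>i<m. if i = 0 then 1 else 0)"
    using pos by (simp add: coeff_sum if_distrib)
  also have "\<dots> = 1"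
    using pos by simp
  finally have g: "?g \<noteq> 0"
    by (metis coeff_0 zero_neq_one)
  have "degree ?g \<le> k * (m - 1)"
    using pos by (intro degree_sum_le) (auto intro!: order.trans[OF degree_monom_le])
  then have g_roots: "card {x. poly ?g x = 0} \<le> k * (m - 1)"
    using card_poly_roots_bound[OF g] by linarith
  have "?f \<noteq> 0"
    using f(1) by (metis coeff_0 zero_neq_one)
  then have "card {x. poly ?f x = 0} \<le> k"
    using card_poly_roots_bound f(2) order.trans by blast
  then have upper: "card {x::'a. x ^ k = 1} \<le> k"
    by (simp add: poly_monom)
  have "UNIV - {0} \<subseteq> {x::'a. x ^ k = 1} \<union> {x. poly ?g x = 0}"
  proof
    fix x :: 'a
    assume "x \<in> UNIV - {0}"
    then have "x \<noteq> 0" by simp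
    have "x * x ^ (k * m) = x * 1"
      using power_card_eq_same[of x] assms by (metis One_nat_def Suc_diff_1 mult.right_neutral
          power_Suc zero_less_card_finite)
    then have "(x ^ k) ^ m = 1"
      using \<open>x \<noteq> 0\<close> by (simp add: power_mult)
    then have "(x ^ k - 1) * (\<Sum>i<m. (x ^ k) ^ i) = 0"
      using power_diff_1_eq[of "x ^ k" m] by simp
    then show "x \<in> {x. x ^ k = 1} \<union> {x. poly ?g x = 0}"
      by (auto simp: poly_sum poly_monom power_mult)
  qed
  then have "card (UNIV - {0::'a}) \<le> card {x::'a. x ^ k = 1} + card {x. poly ?g x = 0}"
    using card_Un_le card_mono[OF finite] order.trans by blast
  then have "k * m \<le> card {x::'a. x ^ k = 1} + k * (m - 1)"
    using g_roots assms by (simp add: card_Diff_singleton)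
  then have "k \<le> card {x::'a. x ^ k = 1}"
    using pos by (cases m) auto
  with upper show ?thesis by simp
qed

text \<open>The trace is a polynomial function of degree at most \<open>2 ^ (m - 1)\<close>; the
  polynomial is nonzero because its linear coefficient is 1.\<close>

lemma card_trace_kernel_le:
  assumes "m > 0"
  shows "card {x::'a::{field,finite}. rel_trace 2 m x = 0} \<le> 2 ^ (m - 1)"
proof -
  let ?g = "\<Sum>i<m. monom 1 (2 ^ i) :: 'a poly"
  have "coeff ?g 1 = (\<Sum>i<m. if i = 0 then 1 else 0)"
    by (auto simp: coeff_sum intro!: sum.cong)
  also have "\<dots> = 1"
    using assms by simp
  finally have g: "?g \<noteq> 0"
    by (metis coeff_0 zero_neq_one)
  have "degree ?g \<le> 2 ^ (m - 1)"
    using assms by (intro degree_sum_le) (auto intro!: order.trans[OF degree_monom_le])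
  then show ?thesis
    using card_poly_roots_bound[OF g] by (simp add: poly_sum poly_monom rel_trace_def)
qed

lemma card_eq_mult_card_if_fibres:
  assumes "finite S" and "finite W" and "f ` S \<subseteq> W" and "\<And>w. w \<in> W \<Longrightarrow> card {z \<in> S. f z = w} = k"
  shows "card S = k * card W"
proof -
  have "(\<Sum>z\<in>S. 1) = (\<Sum>w\<in>W. card {z \<in> S. f z = w})"
    using sum.group[of S W f "\<lambda>_. 1::nat"] assms by simp
  then show ?thesis
    using assms(4) by simp
qed

section \<open>Arithmetic in characteristic two, the Frobenius map and the subfields\<close>

locale quartic_field =
  fixes n q :: nat and field_type :: "'a::{field,finite} itself"
  assumes n_pos: "n \<ge> 1" and q_eq: "q = 2 ^ n" and card_field: "CARD('a) = q ^ 4"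
begin

lemma q_gt_1: "q > 1"
  using n_pos unfolding q_eq by (intro one_less_power) auto

lemma two_eq_0 [simp]: "(2::'a) = 0"
proof -
  have "(2::'a) ^ (n * 4) = 0"
    using of_nat_card_eq_0[where 'a='a] by (simp add: card_field q_eq power_mult)
  then show ?thesis by simp
qed

lemma add_self [simp]: "(x::'a) + x = 0"
  by (metis mult_2 mult_zero_left two_eq_0)

lemma add_self_left [simp]: "(x::'a) + (x + y) = y"
  by (simp flip: add.assoc)

lemma add_eq_0_iff_eq: "(x::'a) + y = 0 \<longleftrightarrow> x = y"
  by (metis add_self add_left_cancel)

lemma eq_add_iff: "(x::'a) + y = z \<longleftrightarrow> x = y + z"
  by (metis add.commute add_self_left)

lemma square_add: "((x::'a) + y)\<^sup>2 = x\<^sup>2 + y\<^sup>2"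
  by (simp add: power2_sum two_eq_0)

lemma square_eq_iff: "(x::'a)\<^sup>2 = y\<^sup>2 \<longleftrightarrow> x = y"
  using ex1_square_root_char_2[OF two_eq_0] by metis

lemma add_power_two_power: "((x::'a) + y) ^ 2 ^ k = x ^ 2 ^ k + y ^ 2 ^ k"
  by (induction k) (simp_all add: power_mult square_add mult.commute[of 2])

definition cj :: "'a \<Rightarrow> 'a" where "cj x = x ^ q"

lemma cj_0 [simp]: "cj 0 = 0" and cj_1 [simp]: "cj 1 = 1"
  using q_gt_1 by (simp_all add: cj_def)

lemma cj_add [simp]: "cj (x + y) = cj x + cj y"
  unfolding cj_def unfolding q_eq by (rule add_power_two_power)

lemma cj_mult [simp]: "cj (x * y) = cj x * cj y"
  by (simp add: cj_def power_mult_distrib)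

lemma cj_divide [simp]: "cj (x / y) = cj x / cj y"
  by (simp add: cj_def power_divide)

lemma cj_power [simp]: "cj (x ^ k) = cj x ^ k"
  by (simp add: cj_def power_commutes flip: power_mult) (simp add: mult.commute)

lemma cj_eq_0_iff [simp]: "cj x = 0 \<longleftrightarrow> x = 0"
  using q_gt_1 by (simp add: cj_def)

lemma cj_cj_cj_cj [simp]: "cj (cj (cj (cj x))) = x"
  using power_card_eq_same[of x]
  by (simp add: cj_def card_field power4_eq_xxxx flip: power_mult)

lemma cj_eq_iff [simp]: "cj x = cj y \<longleftrightarrow> x = y"
  by (metis cj_cj_cj_cj)

lemma cj_cj_eq_power: "cj (cj x) = x ^ q\<^sup>2"
  by (simp add: cj_def power2_eq_square flip: power_mult)

abbreviation Fq :: "'a set" where "Fq \<equiv> {x. cj x = x}"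

abbreviation Fq2 :: "'a set" where "Fq2 \<equiv> {x. cj (cj x) = x}"

abbreviation U :: "'a set" where "U \<equiv> {x. x * cj x = 1}"

lemma card_power_eq_same:
  assumes "(r - 1) * m = q ^ 4 - 1" and "r > 1"
  shows "card {x::'a. x ^ r = x} = r"
proof -
  have "{x::'a. x ^ r = x} = insert 0 {x. x ^ (r - 1) = 1}"
    using assms(2) by (cases r) auto
  moreover have "0 \<notin> {x::'a. x ^ (r - 1) = 1}"
    using assms(2) by (simp add: power_0_left)
  ultimately show ?thesis
    using card_power_eq_1[of "r - 1" m, where 'a='a] assms by (simp add: card_field)
qed

lemma card_Fq: "card Fq = q"
proof -
  have "(q - 1) * (q ^ 3 + q\<^sup>2 + q + 1) = q ^ 4 - 1"
    using q_gt_1 by (simp add: algebra_simps eval_nat_numeral)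
  then show ?thesis
    unfolding cj_def using q_gt_1 by (rule card_power_eq_same)
qed

lemma card_Fq2: "card Fq2 = q\<^sup>2"
proof -
  have "(q\<^sup>2 - 1) * (q\<^sup>2 + 1) = q ^ 4 - 1"
    using q_gt_1 by (simp add: algebra_simps eval_nat_numeral)
  then show ?thesis
    unfolding cj_cj_eq_power by (rule card_power_eq_same) (rule one_less_power[OF q_gt_1], simp)
qed

lemma U_eq_mu: "U = mu (q + 1)"
  by (auto simp: mu_def cj_def)

lemma card_U: "card U = q + 1"
proof -
  have "(q + 1) * ((q - 1) * (q\<^sup>2 + 1)) = q ^ 4 - 1"
    using q_gt_1 by (simp add: algebra_simps eval_nat_numeral)
  then have "card {x::'a. x ^ (q + 1) = 1} = q + 1"
    by (intro card_power_eq_1) (simp add: card_field)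
  then show ?thesis
    by (simp add: cj_def)
qed

text \<open>Applying \<open>cj\<close> to the defining equation shows that \<open>x\<close> and
  \<open>cj (cj x)\<close> are both inverse to \<open>cj x\<close>.\<close>

lemma U_subset_Fq2: "U \<subseteq> Fq2"
proof safe
  fix x assume x: "x * cj x = 1"
  then have "cj x * cj (cj x) = 1"
    by (metis cj_1 cj_mult)
  with x show "cj (cj x) = x"
    by (metis mult.commute mult_left_cancel mult_zero_left zero_neq_one)
qed

section \<open>Traces and Artin--Schreier equations\<close>

lemma rel_trace_split: "rel_trace 2 (l + m) (x::'a) = rel_trace 2 l x + rel_trace 2 m (x ^ 2 ^ l)"
  by (induction m) (simp_all add: rel_trace_def add.assoc power_add flip: power_mult)

text \<open>The sum telescopes because squaring is additive; \<open>y\<close> need not lie in a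
  subfield.\<close>

lemma rel_trace_artin_schreier: "rel_trace 2 m ((y::'a)\<^sup>2 + y) = y ^ 2 ^ m + y"
proof (induction m)
  case (Suc m)
  have "(y\<^sup>2 + y) ^ 2 ^ m = y ^ 2 ^ Suc m + y ^ 2 ^ m"
    by (simp add: add_power_two_power flip: power_mult)
  with Suc show ?case
    by (simp add: rel_trace_def add_ac)
qed (simp add: rel_trace_def)

text \<open>The bridge between trace conditions and conjugation: if \<open>w = y^2 + y\<close> with
  \<open>y\<close> anywhere in the large field, then \<open>w\<close> has trace 1 exactly when
  \<open>cj y = y + 1\<close>.\<close>

lemma rel_trace_n_artin_schreier: "rel_trace 2 n (y\<^sup>2 + y) = cj y + y"
  unfolding cj_def unfolding q_eq by (rule rel_trace_artin_schreier)

lemma artin_schreier_eq_iff: "(y::'a)\<^sup>2 + y = z\<^sup>2 + z \<longleftrightarrow> y = z \<or> y = z + 1"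
proof -
  have "y\<^sup>2 + y = z\<^sup>2 + z \<longleftrightarrow> (y + z) * (y + z + 1) = 0"
    unfolding add_eq_0_iff_eq[of "y\<^sup>2 + y", symmetric] by (simp add: algebra_simps power2_eq_square)
  also have "\<dots> \<longleftrightarrow> y = z \<or> y = z + 1"
    by (simp add: add_eq_0_iff_eq add.assoc)
  finally show ?thesis .
qed

lemma card_artin_schreier_fibre: "card {y. y\<^sup>2 + y = (z::'a)\<^sup>2 + z} = 2"
proof -
  have "{y. y\<^sup>2 + y = z\<^sup>2 + z} = {z, z + 1}"
    by (auto simp: artin_schreier_eq_iff)
  then show ?thesis by simp
qed

text \<open>The map \<open>y^2 + y\<close> is two-to-one, so its image has half the size of the
  field. The image lies in the kernel of the absolute trace, which is no larger, hence the two
  agree. Elements of \<open>Fq2\<close> belong to this kernel.\<close>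

lemma artin_schreier_solvable:
  assumes "w \<in> Fq2"
  obtains z where "z\<^sup>2 + z = w"
proof -
  let ?R = "range (\<lambda>y::'a. y\<^sup>2 + y)" and ?K = "{x::'a. rel_trace 2 (4 * n) x = 0}"
  have "2 * card ?R = q ^ 4"
    using card_eq_mult_card_if_fibres[of UNIV ?R "\<lambda>y::'a. y\<^sup>2 + y" 2]
    by (fastforce simp: card_artin_schreier_fibre card_field)
  also have "\<dots> = 2 * 2 ^ (4 * n - 1)"
    using n_pos by (simp add: q_eq mult.commute flip: power_mult power_Suc)
  finally have "card ?K \<le> card ?R"
    using card_trace_kernel_le[of "4 * n", where 'a='a] n_pos by simp
  moreover have "?R \<subseteq> ?K"
  proof safe
    fix y :: 'a
    have "y ^ 2 ^ (4 * n) = y"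
      using power_card_eq_same[of y] card_field by (simp add: q_eq mult.commute flip: power_mult)
    then show "rel_trace 2 (4 * n) (y\<^sup>2 + y) = 0"
      by (simp add: rel_trace_artin_schreier)
  qed
  ultimately have "?R = ?K"
    by (intro card_seteq) auto
  \<comment> \<open>The absolute trace splits into two halves that coincide for an element of
    \<open>Fq2\<close> and therefore cancel.\<close>
  have "rel_trace 2 (4 * n) w = rel_trace 2 (2 * n) w + rel_trace 2 (2 * n) (w ^ 2 ^ (2 * n))"
    using rel_trace_split[of "2 * n" "2 * n" w] by simp
  moreover have "w ^ 2 ^ (2 * n) = w"
    using assms cj_cj_eq_power[of w] power_mult[of "2::nat" n 2] q_eq by (simp add: mult.commute)
  ultimately have "w \<in> ?K"
    by simp
  then have "w \<in> ?R"
    unfolding \<open>?R = ?K\<close> .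
  then show ?thesis
    using that by auto
qed

text \<open>The trace has too few roots to vanish on all of \<open>Fq\<close>. A nonzero value must
  be 1: with \<open>w = z^2 + z\<close> fixed by \<open>cj\<close>, the element \<open>cj z\<close>
  is \<open>z\<close> or \<open>z + 1\<close>.\<close>

lemma ex_trace_one:
  obtains w where "w \<in> Fq" "rel_trace 2 n w = 1"
proof -
  have "card {x::'a. rel_trace 2 n x = 0} < card Fq"
  proof -
    have "(2::nat) ^ (n - 1) < 2 ^ n"
      using n_pos by (intro power_strict_increasing) auto
    then show ?thesis
      using card_trace_kernel_le[of n, where 'a='a] n_pos card_Fq q_eq by linarith
  qed
  then obtain w where w: "w \<in> Fq" "rel_trace 2 n w \<noteq> 0"
    by (metis (mono_tags, lifting) card_mono finite linorder_not_less mem_Collect_eq subsetI)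
  obtain z where z: "z\<^sup>2 + z = w"
    using w artin_schreier_solvable[of w] by auto
  have "cj (z\<^sup>2 + z) = z\<^sup>2 + z"
    unfolding z using w by simp
  then have "(cj z)\<^sup>2 + cj z = z\<^sup>2 + z"
    by simp
  then have "rel_trace 2 n w \<in> {0, 1}"
    unfolding artin_schreier_eq_iff using z rel_trace_n_artin_schreier[of z] by auto
  with w that show ?thesis by blast
qed

subsection \<open>Reduction to a linear equation\<close>

definition expo :: nat where "expo = q ^ 3 + q\<^sup>2 + q - 1"

lemma expo_pos: "expo > 0"
  using q_gt_1 by (simp add: expo_def)

text \<open>Raising the exponent by 2 gives \<open>1 + q + q^2 + q^3\<close>, so the left side is
  the norm of \<open>x\<close> to \<open>Fq\<close>. It is taken in two stages, through the norm
  \<open>x * cj (cj x)\<close> to \<open>Fq2\<close>.\<close>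

lemma power_expo_mult_square: "x ^ expo * x\<^sup>2 = x * cj (cj x) * cj (x * cj (cj x))"
proof -
  have "expo + 2 = 1 + q + q * q + q * q * q"
    using q_gt_1 by (simp add: expo_def eval_nat_numeral)
  then have "x ^ expo * x\<^sup>2 = x ^ (1 + q + q * q + q * q * q)"
    by (metis power_add)
  then show ?thesis
    by (simp add: cj_def power_add power_mult power_mult_distrib mult_ac)
qed

lemma power_expo_Fq2:
  assumes "x \<in> Fq2"
  shows "x ^ expo = (cj x)\<^sup>2"
proof (cases "x = 0")
  case False
  have "x ^ expo * x\<^sup>2 = (cj x)\<^sup>2 * x\<^sup>2"
    unfolding power_expo_mult_square using assms by (simp add: power2_eq_square mult_ac)
  then show ?thesis
    using False by simp
qed (use expo_pos in simp)

text \<open>An element fixed by \<open>cj\<close> has its square equal to its product with its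
  conjugate. For \<open>e * (x * cj (cj x))\<close> this product is the norm of \<open>x\<close>,
  since \<open>e * cj e = 1\<close>.\<close>

lemma power_expo_eq_square:
  assumes "e \<in> U" and "e * (x * cj (cj x)) \<in> Fq"
  shows "x ^ expo = (e * cj (cj x))\<^sup>2"
proof (cases "x = 0")
  case False
  let ?u = "x * cj (cj x)"
  have "(e * cj (cj x))\<^sup>2 * x\<^sup>2 = e * ?u * (e * ?u)"
    by (simp add: power2_eq_square mult_ac)
  also have "\<dots> = e * ?u * cj (e * ?u)"
    using assms(2) by simp
  also have "\<dots> = (e * cj e) * (?u * cj ?u)"
    by (simp add: mult_ac)
  also have "\<dots> = x ^ expo * x\<^sup>2"
    using assms(1) unfolding power_expo_mult_square by simp
  finally show ?thesis
    using False by simp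
qed (use expo_pos in simp)

lemma diff_eq_square:
  assumes "e \<in> U" "f \<in> U" and y: "y = cj (cj x)"
    and "e * (x * y) \<in> Fq" "f * ((x + 1) * (y + 1)) \<in> Fq"
  shows "x ^ expo + (x + 1) ^ expo = (e * y + f * (y + 1))\<^sup>2"
proof -
  have "x ^ expo = (e * y)\<^sup>2"
    using power_expo_eq_square[of e x] assms by blast
  moreover have "(x + 1) ^ expo = (f * (y + 1))\<^sup>2"
    using power_expo_eq_square[of f "x + 1"] assms by simp
  ultimately show ?thesis
    by (simp add: square_add)
qed

text \<open>For nonzero \<open>u\<close>, take \<open>e\<close> to be the square root of
  \<open>cj u / u\<close>: then \<open>(e * u)^2 = u * cj u\<close> is fixed by \<open>cj\<close>,
  and square roots are unique. For \<open>u = 0\<close> any element of \<open>U\<close>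
  serves.\<close>

lemma ex_U_mult_in_Fq:
  assumes "u \<in> Fq2"
  obtains e where "e \<in> U" "e * u \<in> Fq"
proof (cases "u = 0")
  case False
  obtain e where e: "e\<^sup>2 = cj u / u"
    using ex1_square_root_char_2[OF two_eq_0] by blast
  have ce: "(cj e)\<^sup>2 = u / cj u"
    using arg_cong[OF e, of cj] assms by simp
  have "(e * cj e)\<^sup>2 = 1\<^sup>2"
    using False by (simp add: power_mult_distrib e ce)
  moreover have "(cj (e * u))\<^sup>2 = (e * u)\<^sup>2"
    using False by (simp add: power_mult_distrib e ce) (simp add: power2_eq_square)
  ultimately show ?thesis
    using that[of e] unfolding square_eq_iff by simp
qed (use that[of 1] in simp)

lemma diff_decomposition:
  assumes y: "y = cj (cj x)"
  obtains e f where "e \<in> U" "f \<in> U" "e * (x * y) \<in> Fq" "f * ((x + 1) * (y + 1)) \<in> Fq"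
    and "x ^ expo + (x + 1) ^ expo = (e * y + f * (y + 1))\<^sup>2"
proof -
  have u: "x * y \<in> Fq2" and v: "(x + 1) * (y + 1) \<in> Fq2"
    by (simp_all add: y mult.commute)
  obtain e where "e \<in> U" "e * (x * y) \<in> Fq"
    using ex_U_mult_in_Fq[OF u] .
  moreover obtain f where "f \<in> U" "f * ((x + 1) * (y + 1)) \<in> Fq"
    using ex_U_mult_in_Fq[OF v] .
  ultimately show ?thesis
    using diff_eq_square[OF _ _ y] that by blast
qed

text \<open>On \<open>Fq2\<close> the power map is \<open>(cj x)^2\<close>, which is additive and
  sends 1 to 1.\<close>

lemma diff_Fq2:
  assumes "x \<in> Fq2"
  shows "x ^ expo + (x + 1) ^ expo = 1"
  using power_expo_Fq2[of x] power_expo_Fq2[of "x + 1"] assms by (simp add: square_add)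

text \<open>The linear equation \<open>(e + f) * y = \<beta> + f\<close> has coefficients in
  \<open>Fq2\<close>. If \<open>e\<close> and \<open>f\<close> differed, \<open>y\<close> and hence
  \<open>x\<close> would lie in \<open>Fq2\<close>; so they agree, and both equal
  \<open>\<beta>\<close>.\<close>

lemma diff_eq_square_Fq2_iff:
  assumes x: "x \<notin> Fq2" and \<beta>: "\<beta> \<in> Fq2" and y: "y = cj (cj x)"
  shows "x ^ expo + (x + 1) ^ expo = \<beta>\<^sup>2 \<longleftrightarrow>
    \<beta> \<in> U \<and> \<beta> * (x * y) \<in> Fq \<and> \<beta> * ((x + 1) * (y + 1)) \<in> Fq" (is "?L \<longleftrightarrow> ?R")
proof
  assume ?L
  obtain e f where ef: "e \<in> U" "f \<in> U" "e * (x * y) \<in> Fq" "f * ((x + 1) * (y + 1)) \<in> Fq"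
    and "x ^ expo + (x + 1) ^ expo = (e * y + f * (y + 1))\<^sup>2"
    using diff_decomposition[OF y] .
  with \<open>?L\<close> have "e * y + f * (y + 1) = \<beta>"
    by (metis square_eq_iff)
  then have lin: "(e + f) * y = \<beta> + f"
    by (auto simp: algebra_simps)
  have "e = f"
  proof (rule ccontr)
    assume "e \<noteq> f"
    then have "y = (\<beta> + f) / (e + f)"
      using lin by (simp add: field_simps add_eq_0_iff_eq)
    moreover have "e \<in> Fq2" "f \<in> Fq2"
      using ef U_subset_Fq2 by blast+
    ultimately have "cj (cj y) = y"
      using \<beta> by simp
    then show False
      using x y by simp
  qed
  with lin have "\<beta> = f"
    by (simp add: add_eq_0_iff_eq)
  with ef \<open>e = f\<close> show ?R by blast
next
  assume ?R
  then have "x ^ expo + (x + 1) ^ expo = (\<beta> * y + \<beta> * (y + 1))\<^sup>2"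
    using diff_eq_square[OF _ _ y] by blast
  then show ?L by (simp add: algebra_simps)
qed

section \<open>Scaled Artin--Schreier conditions\<close>

lemma artin_schreier_not_in_Fq:
  assumes "k \<in> Fq" "k \<noteq> 0" "cj (cj z) = z + 1"
  shows "k * (z\<^sup>2 + z) \<notin> Fq"
proof
  assume "k * (z\<^sup>2 + z) \<in> Fq"
  \<comment> \<open>This forces \<open>cj z\<close> to be \<open>z\<close> or \<open>z + 1\<close>,
    and in both cases applying \<open>cj\<close> twice fixes \<open>z\<close>.\<close>
  then have "(cj z)\<^sup>2 + cj z = z\<^sup>2 + z"
    using assms by simp
  then show False
    using assms(3) by (auto simp: artin_schreier_eq_iff)
qed

text \<open>The set \<open>V\<close> of all \<open>z\<close> with \<open>k * (z^2 + z)\<close> in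
  \<open>Fq\<close> has \<open>2 * q\<close> elements, and \<open>cj\<close> applied twice either
  fixes such a \<open>z\<close> or adds 1 to it. Both cases are equally frequent as soon as the
  second one occurs.\<close>

lemma card_artin_schreier_scaled:
  assumes k: "k \<in> Fq2" "k \<notin> Fq"
  shows "card {z. cj (cj z) = z + 1 \<and> k * (z\<^sup>2 + z) \<in> Fq} = q" (is "card ?S = q")
proof -
  define V where "V = {z. k * (z\<^sup>2 + z) \<in> Fq}"
  define V0 where "V0 = {z \<in> V. cj (cj z) = z}"
  have k0: "k \<noteq> 0" and ck: "cj (cj k) = k"
    using k by auto
  have "(\<lambda>a. a / k) ` Fq = {w. k * w \<in> Fq}"
    using k0 by (auto simp: image_iff intro!: exI[of _ "k * _"])
  moreover have "inj_on (\<lambda>a. a / k) Fq"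
    using k0 by (auto simp: inj_on_def)
  ultimately have card_W: "card {w. k * w \<in> Fq} = q"
    by (metis card_Fq card_image)
  have in_Fq2: "w \<in> Fq2" if "k * w \<in> Fq" for w
  proof -
    have "cj (k * w) = k * w"
      using that by simp
    then have "cj (cj (k * w)) = k * w"
      by (simp only:)
    then have "k * cj (cj w) = k * w"
      using ck by simp
    then show ?thesis
      using k0 by simp
  qed
  have "card V = 2 * card {w. k * w \<in> Fq}"
  proof (rule card_eq_mult_card_if_fibres[where f = "\<lambda>z. z\<^sup>2 + z"])
    fix w assume w: "w \<in> {w. k * w \<in> Fq}"
    then obtain z where z: "z\<^sup>2 + z = w"
      using in_Fq2 artin_schreier_solvable by blast
    have "x \<in> V" if "x\<^sup>2 + x = w" for x
      using w that unfolding V_def mem_Collect_eq by (simp only:)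
    then have "{x \<in> V. x\<^sup>2 + x = w} = {x. x\<^sup>2 + x = z\<^sup>2 + z}"
      unfolding z by blast
    then show "card {x \<in> V. x\<^sup>2 + x = w} = 2"
      by (simp add: card_artin_schreier_fibre)
  qed (auto simp: V_def)
  with card_W have card_V: "card V = 2 * q"
    by simp
  have V_cases: "cj (cj z) = z \<or> cj (cj z) = z + 1" if "z \<in> V" for z
  proof -
    have "z\<^sup>2 + z \<in> Fq2"
      using that in_Fq2[of "z\<^sup>2 + z"] unfolding V_def by blast
    then show ?thesis
      by (simp flip: artin_schreier_eq_iff)
  qed
  \<comment> \<open>Nonzero because \<open>k\<close> is not in \<open>Fq\<close>. Scaling by
    \<open>1 / h\<close> is chosen so that \<open>z0 + cj z0\<close> satisfies an Artin--Schreier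
    equation whose right-hand side \<open>w\<close> has trace 1.\<close>
  define h where "h = 1 / k + 1 / cj k"
  have "h \<noteq> 0"
    using k k0 unfolding h_def add_eq_0_iff_eq by auto
  obtain w where w: "w \<in> Fq" "rel_trace 2 n w = 1"
    using ex_trace_one .
  define a where "a = w / h"
  have a: "a \<in> Fq"
    using w ck by (simp add: a_def h_def add.commute)
  then have ak: "k * (a / k) \<in> Fq"
    using k0 by simp
  then obtain z0 where z0: "z0\<^sup>2 + z0 = a / k"
    using in_Fq2 artin_schreier_solvable by blast
  have "(z0 + cj z0)\<^sup>2 + (z0 + cj z0) = (z0\<^sup>2 + z0) + cj (z0\<^sup>2 + z0)"
    by (simp add: square_add add_ac)
  also have "\<dots> = a / k + a / cj k"
    using a unfolding z0 by simp
  also have "\<dots> = a * h"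
    by (simp add: h_def algebra_simps)
  also have "\<dots> = w"
    using \<open>h \<noteq> 0\<close> by (simp add: a_def)
  finally have "cj (z0 + cj z0) + (z0 + cj z0) = 1"
    using w(2) rel_trace_n_artin_schreier[of "z0 + cj z0"] by (simp only:)
  then have "z0 + cj (cj z0) = 1"
    by (simp add: add_ac)
  then have "cj (cj z0) = z0 + 1"
    by (metis add_self_left)
  moreover have "z0 \<in> V"
    using ak unfolding V_def mem_Collect_eq z0 .
  ultimately have z0': "z0 \<in> ?S"
    by (simp add: V_def)
  \<comment> \<open>\<open>V0\<close> is closed under addition and \<open>?S\<close> is its
    translate by \<open>z0\<close>; together they exhaust \<open>V\<close>, so each has half of its
    elements.\<close>
  have "?S = (\<lambda>z. z + z0) ` V0"
  proof
    show "(\<lambda>z. z + z0) ` V0 \<subseteq> ?S"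
      using z0' by (auto simp: V0_def V_def square_add algebra_simps)
    show "?S \<subseteq> (\<lambda>z. z + z0) ` V0"
    proof
      fix z assume "z \<in> ?S"
      then have "z + z0 \<in> V0"
        using z0' by (auto simp: V0_def V_def square_add algebra_simps)
      then show "z \<in> (\<lambda>z. z + z0) ` V0"
        by (intro image_eqI[of _ _ "z + z0"]) (simp_all add: add.assoc)
    qed
  qed
  then have "card ?S = card V0"
    by (simp add: card_image)
  moreover have "V = V0 \<union> ?S"
    using V_cases by (auto simp: V0_def V_def)
  moreover have "V0 \<inter> ?S = {}"
    by (auto simp: V0_def)
  ultimately have "card V = 2 * card ?S"
    by (simp add: card_Un_disjoint)
  with card_V show ?thesis by simp
qed

subsection \<open>Right-hand sides in the quadratic subfield\<close>

text \<open>For a solution \<open>x\<close> outside \<open>Fq2\<close>, the two conditions on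
  products put \<open>s = x + cj (cj x)\<close> into \<open>Fq\<close>. Then
  \<open>z = x / s\<close> satisfies \<open>cj (cj z) = z + 1\<close> while
  \<open>s^2 * (z^2 + z)\<close> lies in \<open>Fq\<close>, which is impossible.\<close>

lemma solutions_one: "{x. x ^ expo + (x + 1) ^ expo = 1} = Fq2"
proof
  show "{x. x ^ expo + (x + 1) ^ expo = 1} \<subseteq> Fq2"
  proof (rule subsetI, rule ccontr)
    fix x
    assume "x \<in> {x. x ^ expo + (x + 1) ^ expo = 1}" and x: "x \<notin> Fq2"
    then have D: "x ^ expo + (x + 1) ^ expo = 1\<^sup>2"
      by simp
    define y where "y = cj (cj x)"
    define s where "s = x + y"
    have s0: "s \<noteq> 0"
      using x unfolding s_def add_eq_0_iff_eq y_def by auto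
    have xy: "x * y \<in> Fq" "(x + 1) * (y + 1) \<in> Fq"
      using D diff_eq_square_Fq2_iff[OF x, of 1 y] y_def by auto
    have "s = (x * y) + ((x + 1) * (y + 1)) + 1"
      by (simp add: s_def algebra_simps)
    also have "\<dots> \<in> Fq"
      using xy by (simp del: cj_mult)
    finally have s: "s \<in> Fq" .
    have y: "y = x + s"
      by (simp add: s_def)
    have "cj (cj (x / s)) = x / s + 1"
      using s s0 y by (simp add: y_def[symmetric] add_divide_distrib)
    moreover have "s\<^sup>2 * ((x / s)\<^sup>2 + x / s) = x * y"
      using s0 unfolding y by (simp add: field_simps power2_eq_square)
    ultimately show False
      using artin_schreier_not_in_Fq[of "s\<^sup>2" "x / s"] s s0 xy(1) by simp
  qed
  show "Fq2 \<subseteq> {x. x ^ expo + (x + 1) ^ expo = 1}"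
    using diff_Fq2 by blast
qed

lemma solutions_Fq2_not_U:
  assumes "\<beta> \<in> Fq2" "\<beta> \<notin> U"
  shows "{x. x ^ expo + (x + 1) ^ expo = \<beta>\<^sup>2} = {}"
proof -
  have "x ^ expo + (x + 1) ^ expo \<noteq> \<beta>\<^sup>2" if "x \<in> Fq2" for x
  proof
    assume "x ^ expo + (x + 1) ^ expo = \<beta>\<^sup>2"
    then have "\<beta>\<^sup>2 = 1\<^sup>2"
      using diff_Fq2[OF that] by simp
    then show False
      using assms(2) unfolding square_eq_iff by simp
  qed
  then show ?thesis
    using diff_eq_square_Fq2_iff assms by blast
qed

text \<open>The two conditions of \<open>diff_eq_square_Fq2_iff\<close> add up to
  \<open>C = \<beta> * (x + cj (cj x) + 1)\<close>, an element of \<open>Fq\<close>. Solutions are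
  sorted by \<open>C\<close>: each \<open>C\<close> other than 1 accounts for \<open>q\<close> of
  them, and \<open>C = 1\<close> for none.\<close>

lemma card_solutions_U:
  assumes \<beta>: "\<beta> \<in> U" "\<beta> \<noteq> 1"
  shows "card {x. x ^ expo + (x + 1) ^ expo = \<beta>\<^sup>2} = q\<^sup>2 - q"
proof -
  define \<gamma> where "\<gamma> = cj \<beta>"
  have \<beta>\<gamma>: "\<beta> * \<gamma> = 1" and c\<beta>: "cj \<beta> = \<gamma>" and c\<gamma>: "cj \<gamma> = \<beta>"
    using \<beta> U_subset_Fq2 by (auto simp: \<gamma>_def)
  have \<beta>0: "\<beta> \<noteq> 0" "\<gamma> \<noteq> 0"
    using \<beta>\<gamma> by auto
  have ne: "\<beta> \<noteq> \<gamma>"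
  proof
    assume "\<beta> = \<gamma>"
    then have "\<beta>\<^sup>2 = 1\<^sup>2"
      using \<beta>\<gamma> by (simp add: power2_eq_square)
    then show False
      using \<beta>(2) by (simp only: square_eq_iff)
  qed
  let ?S = "{x. x ^ expo + (x + 1) ^ expo = \<beta>\<^sup>2}"
  \<comment> \<open>Elements of \<open>Fq2\<close> give the value 1, which differs from
    \<open>\<beta>^2\<close>.\<close>
  have S_iff: "x \<in> ?S \<longleftrightarrow> x \<notin> Fq2 \<and> \<beta> * (x * cj (cj x)) \<in> Fq \<and>
      \<beta> * ((x + 1) * (cj (cj x) + 1)) \<in> Fq" for x
  proof (cases "x \<in> Fq2")
    case True
    have "(1::'a)\<^sup>2 \<noteq> \<beta>\<^sup>2"
      using \<beta>(2) unfolding square_eq_iff by simp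
    then show ?thesis
      using diff_Fq2[OF True] True by simp
  next
    case False
    then show ?thesis
      using diff_eq_square_Fq2_iff[OF False _ refl, of \<beta>] \<beta>(1) U_subset_Fq2 by blast
  qed
  \<comment> \<open>\<open>s C\<close> is the value of \<open>x + cj (cj x)\<close> that
    \<open>C\<close> prescribes. Substituting \<open>x = s C * z\<close> into
    \<open>\<beta> * (x * cj (cj x))\<close> turns it into \<open>k C * (z^2 + z)\<close>.\<close>
  define s where "s C = (\<beta> + C) * \<gamma>" for C
  define k where "k C = (\<beta> + C)\<^sup>2 * \<gamma>" for C
  define Z where "Z C = {z. cj (cj z) = z + 1 \<and> k C * (z\<^sup>2 + z) \<in> Fq}" for C
  have k_eq: "k C = \<beta> + C\<^sup>2 * \<gamma>" for C
  proof -
    have "k C = \<beta> * (\<beta> * \<gamma>) + C\<^sup>2 * \<gamma>"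
      by (simp add: k_def square_add algebra_simps power2_eq_square)
    then show ?thesis
      by (simp add: \<beta>\<gamma>)
  qed
  have k_s: "k C = \<beta> * (s C)\<^sup>2" for C
  proof -
    have "\<beta> * (s C)\<^sup>2 = (\<beta> + C)\<^sup>2 * \<gamma> * (\<beta> * \<gamma>)"
      by (simp add: s_def power2_eq_square mult_ac)
    then show ?thesis
      by (simp add: k_def \<beta>\<gamma>)
  qed
  have \<beta>s: "\<beta> * s C = \<beta> + C" for C
  proof -
    have "\<beta> * s C = (\<beta> + C) * (\<beta> * \<gamma>)"
      by (simp only: s_def mult_ac)
    then show ?thesis
      by (simp add: \<beta>\<gamma>)
  qed
  have s0: "s C \<noteq> 0" and s_Fq2: "s C \<in> Fq2" if "C \<in> Fq" for C
  proof -
    have "\<beta> + C \<noteq> 0"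
      using that ne c\<beta> unfolding add_eq_0_iff_eq by auto
    then show "s C \<noteq> 0"
      by (simp add: s_def \<beta>0)
    show "s C \<in> Fq2"
      using that by (simp add: s_def c\<beta> c\<gamma>)
  qed
  have fibre: "{x \<in> ?S. \<beta> * (x + cj (cj x) + 1) = C} = (\<lambda>z. s C * z) ` Z C" if C: "C \<in> Fq" for C
  proof
    show "{x \<in> ?S. \<beta> * (x + cj (cj x) + 1) = C} \<subseteq> (\<lambda>z. s C * z) ` Z C"
    proof
      fix x
      assume x: "x \<in> {x \<in> ?S. \<beta> * (x + cj (cj x) + 1) = C}"
      define y where "y = cj (cj x)"
      have "\<beta> * (x + y) = \<beta> * s C"
        using x by (auto simp: \<beta>s y_def[symmetric] algebra_simps)
      then have "x + y = s C"
        using \<beta>0 by simp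
      then have y: "y = x + s C"
        by (metis add_self_left)
      have "cj (cj (x / s C)) = x / s C + 1"
        using s_Fq2[OF C] s0[OF C] y by (simp add: y_def[symmetric] add_divide_distrib)
      moreover have "k C * ((x / s C)\<^sup>2 + x / s C) = \<beta> * (x * y)"
        using s0[OF C] unfolding y k_s by (simp add: field_simps power2_eq_square)
      moreover have "\<beta> * (x * y) \<in> Fq"
        using x S_iff unfolding y_def by blast
      ultimately have "x / s C \<in> Z C"
        unfolding Z_def by (simp del: cj_mult)
      then show "x \<in> (\<lambda>z. s C * z) ` Z C"
        using s0[OF C] by (intro image_eqI[of _ _ "x / s C"]) simp_all
    qed
    show "(\<lambda>z. s C * z) ` Z C \<subseteq> {x \<in> ?S. \<beta> * (x + cj (cj x) + 1) = C}"
    proof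
      fix x
      assume "x \<in> (\<lambda>z. s C * z) ` Z C"
      then obtain z where z: "cj (cj z) = z + 1" "k C * (z\<^sup>2 + z) \<in> Fq" and x: "x = s C * z"
        unfolding Z_def by blast
      have y: "cj (cj x) = x + s C"
        using s_Fq2[OF C] z(1) by (simp add: x algebra_simps)
      then have "x \<notin> Fq2"
        using s0[OF C] by simp
      moreover have "\<beta> * (x * cj (cj x)) = k C * (z\<^sup>2 + z)"
        unfolding y k_s unfolding x by (simp add: algebra_simps power2_eq_square)
      with z(2) have xy: "\<beta> * (x * cj (cj x)) \<in> Fq"
        by (simp only:)
      moreover have "\<beta> * (x + cj (cj x) + 1) = C"
        unfolding y using \<beta>s[of C] by (simp add: algebra_simps)
      moreover have "\<beta> * ((x + 1) * (cj (cj x) + 1)) =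
          \<beta> * (x * cj (cj x)) + \<beta> * (x + cj (cj x) + 1)"
        by (simp add: algebra_simps)
      ultimately show "x \<in> {x \<in> ?S. \<beta> * (x + cj (cj x) + 1) = C}"
        unfolding S_iff mem_Collect_eq using C by (simp del: cj_mult)
    qed
  qed
  have C_ne_1: "\<beta> * (x + cj (cj x) + 1) \<in> Fq - {1}" if x: "x \<in> ?S" for x
  proof -
    define C where "C = \<beta> * (x + cj (cj x) + 1)"
    have "C = \<beta> * (x * cj (cj x)) + \<beta> * ((x + 1) * (cj (cj x) + 1))"
      by (simp add: C_def algebra_simps)
    also have "cj \<dots> = \<dots>"
      using x unfolding S_iff cj_add by simp
    ultimately have C: "C \<in> Fq"
      by simp
    have "C \<noteq> 1"
    proof
      assume "C = 1"
      \<comment> \<open>Here \<open>k 1 = \<beta> + \<gamma>\<close> is fixed by \<open>cj\<close>,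
        so \<open>artin_schreier_not_in_Fq\<close> leaves no admissible \<open>z\<close>.\<close>
      have "k 1 \<in> Fq" "k 1 \<noteq> 0"
        using ne by (auto simp: k_eq c\<beta> c\<gamma> add.commute add_eq_0_iff_eq)
      then have "Z 1 = {}"
        using artin_schreier_not_in_Fq by (auto simp: Z_def)
      moreover have "x \<in> {x \<in> ?S. \<beta> * (x + cj (cj x) + 1) = C}"
        using x by (simp add: C_def)
      ultimately show False
        unfolding fibre[OF C] by (simp add: \<open>C = 1\<close>)
    qed
    with C show ?thesis
      by (simp add: C_def)
  qed
  have "card ?S = q * card (Fq - {1})"
  proof (rule card_eq_mult_card_if_fibres[where f = "\<lambda>x. \<beta> * (x + cj (cj x) + 1)"])
    fix C
    assume C: "C \<in> Fq - {1}"
    have "k C \<in> Fq2"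
      using C by (simp add: k_def c\<beta> c\<gamma>)
    moreover have "k C \<notin> Fq"
    proof
      assume "k C \<in> Fq"
      \<comment> \<open>The deviation of \<open>k C\<close> from its conjugate vanishes only for
        \<open>C = 1\<close>.\<close>
      moreover have "(\<beta> + \<gamma>) * (1 + C)\<^sup>2 = k C + cj (k C)"
        using C by (simp add: k_eq c\<beta> c\<gamma> square_add algebra_simps)
      ultimately have "(\<beta> + \<gamma>) * (1 + C)\<^sup>2 = 0"
        by simp
      then show False
        using C ne by (auto simp: add_eq_0_iff_eq)
    qed
    ultimately have "card (Z C) = q"
      unfolding Z_def by (rule card_artin_schreier_scaled)
    moreover have "inj_on (\<lambda>z. s C * z) (Z C)"
      using s0[of C] C by (auto simp: inj_on_def)
    ultimately show "card {x \<in> ?S. \<beta> * (x + cj (cj x) + 1) = C} = q"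
      using fibre[of C] C by (simp add: card_image)
  qed (use C_ne_1 in auto)
  then show ?thesis
    by (simp add: card_Fq card_Diff_singleton algebra_simps power2_eq_square)
qed

subsection \<open>Right-hand sides outside the quadratic subfield\<close>

text \<open>Conjugation inverts \<open>e\<close> and \<open>f\<close>, so in comparing
  \<open>e * u\<close> with its conjugate the factor \<open>e / (e + f)^2\<close> cancels. The
  condition on \<open>e\<close> thus becomes an equation in \<open>f\<close> alone.\<close>

lemma mult_in_Fq_iff_root:
  assumes "e \<in> U" "f \<in> U" "e \<noteq> f"
    and \<nu>: "\<nu> = \<beta> * cj (cj \<beta>)" and \<tau>: "\<tau> = \<beta> + cj (cj \<beta>)"
    and u: "(e + f)\<^sup>2 * u = (\<beta> + f) * (cj (cj \<beta>) + f)"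
  shows "e * u \<in> Fq \<longleftrightarrow> cj (\<nu> + 1) * f\<^sup>2 + (\<tau> + cj \<tau>) * f + (\<nu> + 1) = 0"
proof -
  define P where "P = \<nu> + f * \<tau> + f\<^sup>2"
  define e' f' where "e' = cj e" and "f' = cj f"
  have units: "e * e' = 1" "f * f' = 1"
    using assms by (auto simp: e'_def f'_def)
  then have nz: "e \<noteq> 0" "f \<noteq> 0" "e' \<noteq> 0" "f' \<noteq> 0"
    by auto
  have e': "e' = 1 / e" and f': "f' = 1 / f"
    using units nz by (simp_all add: field_simps)
  have sum_nz: "e + f \<noteq> 0"
    using assms by (simp add: add_eq_0_iff_eq)
  have "(e + f)\<^sup>2 * u = P"
    unfolding u P_def \<nu> \<tau> by (simp add: algebra_simps power2_eq_square)
  then have u_eq: "u = P / (e + f)\<^sup>2"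
    using sum_nz by (simp add: field_simps)
  have "cj (e * u) = e' * cj P / (e' + f')\<^sup>2"
    by (simp add: u_eq e'_def f'_def)
  also have "\<dots> = e * f\<^sup>2 * cj P / (e + f)\<^sup>2"
    using nz sum_nz unfolding e' f' by (simp add: field_simps power2_eq_square)
  finally have "e * u \<in> Fq \<longleftrightarrow> e * f\<^sup>2 * cj P / (e + f)\<^sup>2 = e * P / (e + f)\<^sup>2"
    by (simp add: u_eq)
  also have "\<dots> \<longleftrightarrow> f\<^sup>2 * cj P + P = 0"
    using nz sum_nz by (simp add: add_eq_0_iff_eq)
  also have "f\<^sup>2 * cj P + P = cj (\<nu> + 1) * f\<^sup>2 + (\<tau> + cj \<tau>) * f + (\<nu> + 1)"
  proof -
    have "f\<^sup>2 * cj P = f\<^sup>2 * cj \<nu> + f * (f * f') * cj \<tau> + (f * f')\<^sup>2"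
      by (simp add: P_def f'_def algebra_simps power2_eq_square)
    then show ?thesis
      unfolding units by (simp add: P_def algebra_simps)
  qed
  finally show ?thesis .
qed

text \<open>Since \<open>\<beta> + f = (e + f) * y\<close> and
  \<open>\<beta> + e = (e + f) * (y + 1)\<close>, the condition on \<open>x * y\<close> makes
  \<open>f\<close> a root and the one on \<open>(x + 1) * (y + 1)\<close> makes \<open>e\<close> a
  root. Equality \<open>e = f\<close> would give \<open>\<beta> = f\<close>, an element of
  \<open>Fq2\<close>.\<close>

lemma diff_eq_square_iff_roots:
  assumes \<beta>: "\<beta> \<notin> Fq2" and \<nu>: "\<nu> = \<beta> * cj (cj \<beta>)" and \<tau>: "\<tau> = \<beta> + cj (cj \<beta>)"
    and R: "R = {Z \<in> U. cj (\<nu> + 1) * Z\<^sup>2 + (\<tau> + cj \<tau>) * Z + (\<nu> + 1) = 0}"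
  shows "x ^ expo + (x + 1) ^ expo = \<beta>\<^sup>2 \<longleftrightarrow>
    (\<exists>e\<in>R. \<exists>f\<in>R. e \<noteq> f \<and> x = (cj (cj \<beta>) + f) / (e + f))" (is "?L \<longleftrightarrow> ?E")
proof -
  define y where "y = cj (cj x)"
  have cy: "cj (cj y) = x"
    by (simp add: y_def)
  have roots: "e * (x * y) \<in> Fq \<and> f * ((x + 1) * (y + 1)) \<in> Fq \<longleftrightarrow> e \<in> R \<and> f \<in> R"
    if ef: "e \<in> U" "f \<in> U" "e \<noteq> f" and b: "\<beta> = e * y + f * (y + 1)" for e f
  proof -
    have c: "cj (cj e) = e" "cj (cj f) = f"
      using ef U_subset_Fq2 by blast+
    have b2: "cj (cj \<beta>) = e * x + f * (x + 1)"
      by (simp add: b c cy)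
    have "e * (x * y) \<in> Fq \<longleftrightarrow> f \<in> R"
      unfolding R using mult_in_Fq_iff_root[OF ef \<nu> \<tau>, of "x * y"] ef
      unfolding b2 unfolding b by (simp add: algebra_simps power2_eq_square)
    moreover have "f * ((x + 1) * (y + 1)) \<in> Fq \<longleftrightarrow> e \<in> R"
      unfolding R using mult_in_Fq_iff_root[OF ef(2,1) _ \<nu> \<tau>, of "(x + 1) * (y + 1)"] ef
      unfolding b2 unfolding b by (simp add: algebra_simps power2_eq_square)
    ultimately show ?thesis by blast
  qed
  show ?thesis
  proof
    assume ?L
    obtain e f where ef: "e \<in> U" "f \<in> U" "e * (x * y) \<in> Fq" "f * ((x + 1) * (y + 1)) \<in> Fq"
      and "x ^ expo + (x + 1) ^ expo = (e * y + f * (y + 1))\<^sup>2"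
      using diff_decomposition[OF y_def] .
    with \<open>?L\<close> have b: "\<beta> = e * y + f * (y + 1)"
      by (metis square_eq_iff)
    have c: "cj (cj e) = e" "cj (cj f) = f"
      using ef U_subset_Fq2 by blast+
    have "e \<noteq> f"
    proof
      assume "e = f"
      then have "\<beta> = f"
        unfolding b by (simp add: algebra_simps)
      then show False
        using \<beta> c by simp
    qed
    moreover have "x = (cj (cj \<beta>) + f) / (e + f)"
      using \<open>e \<noteq> f\<close> by (simp add: b c cy field_simps add_eq_0_iff_eq)
    ultimately show ?E
      using roots[of e f] ef b by blast
  next
    assume ?E
    then obtain e f where ef: "e \<in> R" "f \<in> R" "e \<noteq> f" and x: "x = (cj (cj \<beta>) + f) / (e + f)"
      by blast
    then have U: "e \<in> U" "f \<in> U"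
      by (simp_all add: R)
    then have c: "cj (cj e) = e" "cj (cj f) = f"
      using U_subset_Fq2 by blast+
    have "y = (\<beta> + f) / (e + f)"
      by (simp add: y_def x c)
    then have "(e + f) * y = \<beta> + f"
      using ef by (simp add: add_eq_0_iff_eq)
    then have "(e + f) * y + f = \<beta>"
      by (simp add: add.assoc)
    then have b: "\<beta> = e * y + f * (y + 1)"
      by (auto simp: algebra_simps)
    have "e * (x * y) \<in> Fq" "f * ((x + 1) * (y + 1)) \<in> Fq"
      using roots[OF U ef(3) b] ef by blast+
    then show ?L
      using diff_eq_square[OF U y_def] by (simp only: b)
  qed
qed

text \<open>Needed to exclude the quadratic with all coefficients zero. The pairs
  \<open>\<beta>, cj (cj \<beta>)\<close> and \<open>cj \<beta>, cj (cj (cj \<beta>))\<close> have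
  the same sum and product, so they are the roots of one quadratic and \<open>cj \<beta>\<close> is
  in the first pair.\<close>

lemma in_Fq2_if_norm_trace:
  assumes "\<beta> * cj (cj \<beta>) = 1" and "\<beta> + cj (cj \<beta>) \<in> Fq"
  shows "\<beta> \<in> Fq2"
proof -
  define g where "g = cj \<beta>"
  have prod: "g * cj (cj g) = 1"
    using arg_cong[OF assms(1), of cj] by (simp add: g_def)
  have sum: "\<beta> + cj g = g + cj (cj g)"
    using assms(2) by (simp add: g_def)
  have "(g + \<beta>) * (g + cj g) = g * g + g * (\<beta> + cj g) + \<beta> * cj g"
    by (simp add: algebra_simps)
  also have "\<dots> = g * cj (cj g) + \<beta> * cj g"
    unfolding sum by (simp add: algebra_simps)
  also have "\<dots> = 0"
    unfolding prod using assms(1) by (simp add: g_def)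
  finally have "g = \<beta> \<or> g = cj g"
    by (simp add: add_eq_0_iff_eq)
  then show ?thesis
    by (auto simp: g_def)
qed

section \<open>The set \<open>Lambda\<close> expressed through square roots\<close>

lemma half_power_square: "half_power (x\<^sup>2) (q + 1) = x * cj x"
proof -
  have eq: "(x\<^sup>2) ^ (q + 1) = (x * cj x)\<^sup>2"
    by (simp add: cj_def power_mult_distrib mult.commute flip: power_mult)
  show ?thesis
    unfolding half_power_def eq square_eq_iff by simp
qed

text \<open>For the square of \<open>\<beta>\<close>, all the traces and norms in
  \<open>Lambda\<close> are squares of those formed from \<open>\<beta>\<close>, which resolves the
  half power explicitly. The condition that the element is nonzero follows from the nonzero
  denominator.\<close>

lemma Lambda_iff:
  assumes \<nu>: "\<nu> = \<beta> * cj (cj \<beta>)" and \<tau>: "\<tau> = \<beta> + cj (cj \<beta>)"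
  shows "\<beta>\<^sup>2 \<in> Lambda n \<longleftrightarrow> \<tau> + cj \<tau> \<noteq> 0 \<and>
    rel_trace 2 n ((\<nu> + 1) * cj (\<nu> + 1) / (\<tau> + cj \<tau>)\<^sup>2) = 1"
proof -
  have two: "{..<2::nat} = {0, 1}"
    by auto
  have t: "rel_trace (q\<^sup>2) 2 (\<beta>\<^sup>2) = \<tau>\<^sup>2"
    by (simp add: rel_trace_def two \<tau> square_add flip: cj_cj_eq_power)
  have m: "rel_norm (q\<^sup>2) 2 (\<beta>\<^sup>2) = \<nu>\<^sup>2"
    by (simp add: rel_norm_def two \<nu> power_mult_distrib flip: cj_cj_eq_power)
  have t': "\<tau>\<^sup>2 + (\<tau>\<^sup>2) ^ q = (\<tau> + cj \<tau>)\<^sup>2"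
    by (simp add: square_add flip: cj_def)
  have m': "\<nu>\<^sup>2 + 1 = (\<nu> + 1)\<^sup>2"
    by (simp add: square_add)
  have "\<beta> \<noteq> 0" if "\<tau> + cj \<tau> \<noteq> 0"
    using that \<tau> by auto
  then show ?thesis
    unfolding Lambda_def Let_def mem_Collect_eq q_eq[symmetric] t m t' m' half_power_square by auto
qed

text \<open>Scaling the quadratic to \<open>w^2 + w = M * cj M / t^2\<close> makes the trace
  condition say that \<open>cj\<close> interchanges the two roots \<open>w\<close>. This is
  equivalent to the original roots lying in \<open>U\<close>.\<close>

lemma solutions_not_in_Fq2:
  assumes \<beta>: "\<beta> \<notin> Fq2"
  shows "card {x. x ^ expo + (x + 1) ^ expo = \<beta>\<^sup>2} = (if \<beta>\<^sup>2 \<in> Lambda n then 2 else 0)"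
proof -
  define \<nu> where "\<nu> = \<beta> * cj (cj \<beta>)"
  define \<tau> where "\<tau> = \<beta> + cj (cj \<beta>)"
  define t where "t = \<tau> + cj \<tau>"
  define M where "M = \<nu> + 1"
  define R where "R = {Z \<in> U. cj M * Z\<^sup>2 + t * Z + M = 0}"
  let ?S = "{x. x ^ expo + (x + 1) ^ expo = \<beta>\<^sup>2}"
  have S: "x \<in> ?S \<longleftrightarrow> (\<exists>e\<in>R. \<exists>f\<in>R. e \<noteq> f \<and> x = (cj (cj \<beta>) + f) / (e + f))" for x
    using diff_eq_square_iff_roots[OF \<beta> \<nu>_def \<tau>_def R_def[unfolded t_def M_def]] by simp
  have Lam: "\<beta>\<^sup>2 \<in> Lambda n \<longleftrightarrow> t \<noteq> 0 \<and> rel_trace 2 n (M * cj M / t\<^sup>2) = 1"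
    using Lambda_iff[OF \<nu>_def \<tau>_def] by (simp add: t_def M_def)
  have c\<tau>: "cj (cj \<tau>) = \<tau>"
    by (simp add: \<tau>_def add.commute)
  have ct: "cj t = t"
    by (simp add: t_def c\<tau> add.commute)
  have cM: "cj (cj M) = M"
    by (simp add: M_def \<nu>_def mult.commute)
  show ?thesis
  proof (cases "\<beta>\<^sup>2 \<in> Lambda n")
    case True
    then have t0: "t \<noteq> 0" and tr: "rel_trace 2 n (M * cj M / t\<^sup>2) = 1"
      using Lam by auto
    have M0: "M \<noteq> 0"
      using tr by (auto simp: rel_trace_def power_0_left)
    have "M * cj M / t\<^sup>2 \<in> Fq2"
      by (simp add: ct cM)
    then obtain z where z: "z\<^sup>2 + z = M * cj M / t\<^sup>2"
      using artin_schreier_solvable by blast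
    have "cj z + z = 1"
      using tr unfolding z[symmetric] rel_trace_n_artin_schreier .
    then have cz: "cj z = z + 1"
      by (simp add: eq_add_iff)
    have root_iff: "cj M * (t / cj M * w)\<^sup>2 + t * (t / cj M * w) + M = 0 \<longleftrightarrow> w = z \<or> w = z + 1" for w
    proof -
      have "cj M * (t / cj M * w)\<^sup>2 + t * (t / cj M * w) + M = t\<^sup>2 / cj M * (w\<^sup>2 + w) + M"
        using M0 by (simp add: field_simps power2_eq_square)
      also have "\<dots> = 0 \<longleftrightarrow> w\<^sup>2 + w = z\<^sup>2 + z"
        unfolding add_eq_0_iff_eq z using M0 t0 by (simp add: field_simps)
      finally show ?thesis
        by (simp add: artin_schreier_eq_iff)
    qed
    define e f where "e = t / cj M * z" and "f = t / cj M * (z + 1)"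
    have zz: "z * (z + 1) * t\<^sup>2 = M * cj M"
      using z t0 by (simp add: field_simps power2_eq_square)
    have "e * cj e = z * (z + 1) * t\<^sup>2 / (M * cj M)"
      by (simp add: e_def ct cM cz power2_eq_square mult_ac)
    then have eU: "e \<in> U"
      unfolding zz using M0 by simp
    have "f * cj f = z * (z + 1) * t\<^sup>2 / (M * cj M)"
      by (simp add: f_def ct cM cz power2_eq_square mult_ac)
    then have fU: "f \<in> U"
      unfolding zz using M0 by simp
    have R: "R = {e, f}"
    proof
      show "{e, f} \<subseteq> R"
        using eU fU root_iff[of z] root_iff[of "z + 1"] by (simp add: R_def e_def f_def)
      show "R \<subseteq> {e, f}"
      proof
        fix Z assume Z: "Z \<in> R"
        define w where "w = Z * cj M / t"
        have Zw: "Z = t / cj M * w"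
          using M0 t0 by (simp add: w_def)
        then show "Z \<in> {e, f}"
          using Z root_iff[of w] by (auto simp: R_def e_def f_def)
      qed
    qed
    have "e + f = t / cj M"
      unfolding e_def f_def distrib_left[symmetric] by simp
    then have ef0: "e + f \<noteq> 0"
      using t0 M0 by simp
    then have "e \<noteq> f"
      by auto
    \<comment> \<open>Interchanging the two roots replaces \<open>x\<close> by
      \<open>x + 1\<close>.\<close>
    have "?S = {(cj (cj \<beta>) + f) / (e + f), (cj (cj \<beta>) + e) / (e + f)}"
      using S \<open>e \<noteq> f\<close> unfolding R by (auto simp: add.commute)
    then show ?thesis
      using True \<open>e \<noteq> f\<close> ef0 by (simp add: card_insert_if)
  next
    case False
    have "?S = {}"
    proof (rule ccontr)
      assume "?S \<noteq> {}"
      then obtain e f where ef: "e \<in> R" "f \<in> R" "e \<noteq> f"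
        using S by blast
      have re: "cj M * e\<^sup>2 + t * e + M = 0" and rf: "cj M * f\<^sup>2 + t * f + M = 0"
        using ef by (auto simp: R_def)
      have "(e + f) * (cj M * (e + f) + t) = (cj M * e\<^sup>2 + t * e + M) + (cj M * f\<^sup>2 + t * f + M)"
        by (simp add: algebra_simps power2_eq_square)
      then have "cj M * (e + f) = t"
        unfolding re rf using ef(3) by (simp add: add_eq_0_iff_eq)
      then have t: "t = cj M * (e + f)"
        by simp
      have M: "M = cj M * e * f"
      proof -
        have "cj M * e * f = cj M * e\<^sup>2 + t * e"
          unfolding t by (simp add: algebra_simps power2_eq_square)
        then show ?thesis
          using re unfolding add_eq_0_iff_eq by simp
      qed
      \<comment> \<open>If \<open>M\<close> vanished, so would \<open>t\<close>, and
        \<open>\<beta>\<close> would have norm 1 and trace in \<open>Fq\<close>.\<close>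
      have M0: "M \<noteq> 0"
      proof
        assume "M = 0"
        with t have "t = 0"
          by simp
        have "\<beta> * cj (cj \<beta>) = 1"
          using \<open>M = 0\<close> by (simp add: M_def \<nu>_def add_eq_0_iff_eq)
        moreover have "\<beta> + cj (cj \<beta>) \<in> Fq"
          using \<open>t = 0\<close> unfolding t_def add_eq_0_iff_eq \<tau>_def by (simp add: add.commute)
        ultimately show False
          using in_Fq2_if_norm_trace \<beta> by blast
      qed
      have sum0: "e + f \<noteq> 0"
        using ef(3) by (simp add: add_eq_0_iff_eq)
      then have t0: "t \<noteq> 0"
        using M0 by (simp add: t)
      have units: "e * cj e = 1" "f * cj f = 1"
        using ef by (auto simp: R_def)
      have nz: "e \<noteq> 0" "f \<noteq> 0"
        using units by auto
      have ce: "cj e = 1 / e" and cf: "cj f = 1 / f"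
        using units nz by (simp_all add: field_simps)
      \<comment> \<open>This inverts the scaling of the quadratic. As \<open>cj\<close> inverts
        \<open>e\<close> and \<open>f\<close>, it sends \<open>z\<close> to
        \<open>f / (e + f) = z + 1\<close>.\<close>
      define z where "z = e / (e + f)"
      have "z + f / (e + f) = 1"
        using sum0 by (simp add: z_def flip: add_divide_distrib)
      then have z1: "z + 1 = f / (e + f)"
        by (metis add_self_left)
      have "M * cj M / t\<^sup>2 = M * cj M / (cj M * (e + f))\<^sup>2"
        by (simp only: t)
      also have "\<dots> = (cj M * e * f) * cj M / (cj M * (e + f))\<^sup>2"
        by (simp only: M[symmetric])
      also have "\<dots> = z * (z + 1)"
        using M0 unfolding z1 by (simp add: z_def power2_eq_square)
      also have "\<dots> = z\<^sup>2 + z"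
        by (simp add: algebra_simps power2_eq_square)
      finally have w: "M * cj M / t\<^sup>2 = z\<^sup>2 + z" .
      have "cj z = z + 1"
        using nz sum0 unfolding z1 by (simp add: z_def ce cf field_simps)
      then have "cj z + z = 1"
        by (simp add: add.commute)
      then have "rel_trace 2 n (M * cj M / t\<^sup>2) = 1"
        unfolding w rel_trace_n_artin_schreier .
      then show False
        using False Lam t0 by blast
    qed
    with False show ?thesis
      by simp
  qed
qed

subsection \<open>The differential spectrum\<close>

lemma square_in_U_iff: "\<beta>\<^sup>2 \<in> U \<longleftrightarrow> \<beta> \<in> U"
proof -
  have "\<beta>\<^sup>2 \<in> U \<longleftrightarrow> (\<beta> * cj \<beta>)\<^sup>2 = 1\<^sup>2"
    by (simp add: power_mult_distrib)
  also have "\<dots> \<longleftrightarrow> \<beta> \<in> U"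
    unfolding square_eq_iff by simp
  finally show ?thesis .
qed

text \<open>The trace \<open>\<beta> + cj (cj \<beta>)\<close> vanishes on \<open>Fq2\<close>,
  against the nonzero denominator in \<open>Lambda\<close>.\<close>

lemma square_Fq2_not_in_Lambda: "\<beta> \<in> Fq2 \<Longrightarrow> \<beta>\<^sup>2 \<notin> Lambda n"
  using Lambda_iff[OF refl refl, of \<beta>] by simp

lemma U_Int_Lambda: "U \<inter> Lambda n = {}"
proof -
  have "b \<notin> Lambda n" if "b \<in> U" for b
  proof -
    obtain \<beta> where "\<beta>\<^sup>2 = b"
      using ex1_square_root_char_2[OF two_eq_0] by blast
    then show ?thesis
      using that square_in_U_iff[of \<beta>] square_Fq2_not_in_Lambda[of \<beta>] U_subset_Fq2 by blast
  qed
  then show ?thesis by blast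
qed

text \<open>The cases are separated by the position of the square root \<open>\<beta>\<close> of
  \<open>b\<close>; squaring respects membership in \<open>U\<close>.\<close>

lemma card_solutions:
  "card {x. x ^ expo + (x + 1) ^ expo = b} =
    (if b = 1 then q\<^sup>2 else if b \<in> U then q\<^sup>2 - q else if b \<in> Lambda n then 2 else 0)"
proof -
  obtain \<beta> where \<beta>: "\<beta>\<^sup>2 = b"
    using ex1_square_root_char_2[OF two_eq_0] by blast
  consider "b = 1" | "b \<noteq> 1" "\<beta> \<in> U" | "\<beta> \<in> Fq2" "\<beta> \<notin> U" | "b \<noteq> 1" "\<beta> \<notin> Fq2"
    by auto
  then show ?thesis
  proof cases
    case 1
    then show ?thesis
      by (simp add: solutions_one card_Fq2)
  next
    case 2
    moreover have "\<beta> \<noteq> 1"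
      using 2 \<beta> by auto
    ultimately show ?thesis
      using card_solutions_U[of \<beta>] square_in_U_iff[of \<beta>] unfolding \<beta> by presburger
  next
    case 3
    then have "b \<notin> U" "b \<notin> Lambda n"
      using square_in_U_iff[of \<beta>] square_Fq2_not_in_Lambda[of \<beta>] unfolding \<beta> by blast+
    moreover have "b \<noteq> 1"
      using \<open>b \<notin> U\<close> by auto
    ultimately show ?thesis
      using solutions_Fq2_not_U[OF 3] unfolding \<beta> by simp
  next
    case 4
    then have "b \<notin> U"
      using square_in_U_iff[of \<beta>] U_subset_Fq2 unfolding \<beta> by blast
    then show ?thesis
      using 4 solutions_not_in_Fq2[OF 4(2)] unfolding \<beta> by presburger
  qed
qed

lemma one_in_U: "1 \<in> U"
  by simp

lemma card_U_Diff_one: "card (U - {1}) = q"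
  unfolding card_Diff_singleton[OF one_in_U] card_U by simp

lemma two_half_cube: "2 * (q ^ 3 div 2) = q ^ 3"
  using n_pos by (simp add: q_eq)

lemma card_Lambda: "card (Lambda n :: 'a set) = q ^ 3 div 2 * (q - 1)"
proof -
  let ?D = "\<lambda>x::'a. x ^ expo + (x + 1) ^ expo"
  have sum_if: "(\<Sum>b\<in>UNIV. if b \<in> A then c else 0) = card A * c" for A :: "'a set" and c :: nat
    by (simp add: sum.If_cases)
  have "q ^ 4 = (\<Sum>b\<in>UNIV. card {x. ?D x = b})"
    using sum.group[of "UNIV :: 'a set" UNIV ?D "\<lambda>_. 1::nat"] by (simp add: card_field)
  also have "\<dots> = (\<Sum>b\<in>UNIV. (if b \<in> {1} then q\<^sup>2 else 0) + (if b \<in> U - {1} then q\<^sup>2 - q else 0) +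
      (if b \<in> Lambda n then 2 else 0))"
    unfolding card_solutions using U_Int_Lambda one_in_U by (intro sum.cong refl) auto
  also have "\<dots> = q\<^sup>2 + q * (q\<^sup>2 - q) + card (Lambda n :: 'a set) * 2"
    unfolding sum.distrib sum_if card_U_Diff_one by simp
  \<comment> \<open>The values in \<open>U\<close> account for \<open>q ^ 3\<close> of the
    \<open>q ^ 4\<close> elements \<open>x\<close>; the others are shared out in pairs over
    \<open>Lambda\<close>.\<close>
  also have "q\<^sup>2 + q * (q\<^sup>2 - q) = q ^ 3"
    using q_gt_1 by (simp add: algebra_simps power2_eq_square power3_eq_cube)
  finally have "2 * card (Lambda n :: 'a set) = q ^ 3 * q - q ^ 3"
    by (simp add: eval_nat_numeral)
  also have "\<dots> = q ^ 3 * (q - 1)"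
    by (simp add: right_diff_distrib')
  also have "\<dots> = 2 * (q ^ 3 div 2) * (q - 1)"
    by (simp only: two_half_cube)
  finally show ?thesis by simp
qed

lemma card_no_solutions: "card (- (U \<union> Lambda n)) = (q ^ 3 div 2 - 1) * (q + 1)"
proof -
  define a where "a = q ^ 3 div 2"
  have "a > 0"
    using two_half_cube q_gt_1 unfolding a_def by (intro Nat.gr0I) auto
  \<comment> \<open>Successor forms remove the truncated subtractions from the identity.\<close>
  then obtain a' q' where "a = Suc a'" "q = Suc q'"
    using q_gt_1 by (metis Suc_pred less_trans zero_less_one)
  then have "(a - 1) * (q + 1) + (q + 1 + a * (q - 1)) = 2 * a * q"
    by (simp add: algebra_simps)
  also have "\<dots> = q ^ 4"
    unfolding a_def two_half_cube by (simp add: eval_nat_numeral)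
  finally have total: "(a - 1) * (q + 1) + (q + 1 + a * (q - 1)) = q ^ 4" .
  have "card (U \<union> Lambda n) = q + 1 + a * (q - 1)"
    using U_Int_Lambda by (simp only: card_Un_disjoint finite card_U card_Lambda a_def)
  then have "card (- (U \<union> Lambda n)) = q ^ 4 - (q + 1 + a * (q - 1))"
    by (simp only: Compl_eq_Diff_UNIV card_Diff_subset finite subset_UNIV card_field)
  then show ?thesis
    unfolding total[symmetric] a_def[symmetric] by simp
qed

text \<open>For \<open>n = 1\<close> the indices 2 and \<open>q^2 - q\<close> coincide, so the
  counts of \<open>Lambda\<close> and \<open>U - {1}\<close> add up. For larger \<open>n\<close> the
  special indices are distinct, and the remaining even indices appear with value zero.\<close>

lemma diff_spectrum_power_expo:
  "diff_spectrum (\<lambda>x::'a. x ^ expo) =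
    (if n = 1 then {(0, (q ^ 3 div 2 - 1) * (q + 1)), (2, q ^ 3 div 2 * (q - 1) + q), (q\<^sup>2, 1)}
     else {(0, (q ^ 3 div 2 - 1) * (q + 1)), (2, q ^ 3 div 2 * (q - 1)), (q\<^sup>2, 1), (q\<^sup>2 - q, q)} \<union>
       {(i, 0) | i. even i \<and> i \<le> q\<^sup>2 \<and> i \<notin> {0, 2, q\<^sup>2, q\<^sup>2 - q}})"
proof -
  let ?F = "\<lambda>x::'a. x ^ expo"
  have count: "diff_count ?F 1 b =
    (if b = 1 then q\<^sup>2 else if b \<in> U then q\<^sup>2 - q else if b \<in> Lambda n then 2 else 0)" for b
    unfolding diff_count_def card_solutions[symmetric] by (simp only: add.commute)
  have q2: "q\<^sup>2 \<ge> 2 * q"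
    using q_gt_1 by (simp add: power2_eq_square)
  have "Max (range (diff_count ?F 1)) = q\<^sup>2"
  proof (rule Max_eqI)
    show "y \<le> q\<^sup>2" if "y \<in> range (diff_count ?F 1)" for y
      using that q2 q_gt_1 by (auto simp: count)
    show "q\<^sup>2 \<in> range (diff_count ?F 1)"
      by (intro image_eqI[of _ _ 1]) (simp_all add: count)
  qed simp
  then have spec: "diff_spectrum ?F = (\<lambda>i. (i, diff_w ?F i)) ` {i. even i \<and> i \<le> q\<^sup>2}"
    by (simp add: diff_spectrum_def setcompr_eq_image)
  have w: "diff_w ?F i = card {b. (if b = 1 then q\<^sup>2 else if b \<in> U then q\<^sup>2 - q
      else if b \<in> Lambda n then 2 else 0) = i}" for i
    unfolding diff_w_def count ..
  have L1: "b \<notin> U" "b \<noteq> 1" if "b \<in> Lambda n" for b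
    using that U_Int_Lambda one_in_U by blast+
  have w0: "diff_w ?F 0 = (q ^ 3 div 2 - 1) * (q + 1)"
  proof -
    have "{b. (if b = 1 then q\<^sup>2 else if b \<in> U then q\<^sup>2 - q
      else if b \<in> Lambda n then 2 else 0) = 0} = - (U \<union> Lambda n)"
      using q2 q_gt_1 one_in_U by auto
    then show ?thesis
      by (simp only: w card_no_solutions)
  qed
  have wq: "diff_w ?F (q\<^sup>2) = 1"
  proof -
    have "q\<^sup>2 - q \<noteq> q\<^sup>2" "q\<^sup>2 \<noteq> 2" "q\<^sup>2 \<noteq> 0"
      using q2 q_gt_1 by auto
    then have "{b. (if b = 1 then q\<^sup>2 else if b \<in> U then q\<^sup>2 - q
      else if b \<in> Lambda n then 2 else 0) = q\<^sup>2} = {1}"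
      by auto
    then show ?thesis
      by (simp add: w)
  qed
  show ?thesis
  proof (cases "n = 1")
    case True
    then have q: "q = 2"
      by (simp add: q_eq)
    then have qq: "q\<^sup>2 = 4" "q\<^sup>2 - q = 2"
      by simp_all
    have "{b. (if b = 1 then q\<^sup>2 else if b \<in> U then q\<^sup>2 - q
      else if b \<in> Lambda n then 2 else 0) = 2} = Lambda n \<union> (U - {1})"
      using L1 qq by auto
    moreover have "Lambda n \<inter> (U - {1}) = {}"
      using U_Int_Lambda by blast
    ultimately have w2: "diff_w ?F 2 = q ^ 3 div 2 * (q - 1) + q"
      unfolding w by (simp only: card_Un_disjoint finite card_Lambda card_U_Diff_one)
    have "{i. even i \<and> i \<le> q\<^sup>2} = {0, 2, q\<^sup>2}"
    proof -
      have "even i \<and> i \<le> 4 \<longleftrightarrow> i = 0 \<or> i = 2 \<or> i = 4" for i :: nat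
        by presburger
      then show ?thesis
        unfolding qq set_eq_iff by simp
    qed
    then have "diff_spectrum ?F = (\<lambda>i. (i, diff_w ?F i)) ` {0, 2, q\<^sup>2}"
      by (simp only: spec)
    then show ?thesis
      using True by (simp only: image_insert image_empty w0 w2 wq if_True refl)
  next
    case False
    \<comment> \<open>The bound 4 is what separates \<open>q^2 - q\<close> from 2.\<close>
    then have "q \<ge> 2\<^sup>2"
      unfolding q_eq using n_pos by (intro power_increasing) auto
    then have q4: "q \<ge> 4"
      by simp
    then have "q\<^sup>2 \<ge> 4 * q"
      by (simp add: power2_eq_square)
    then have ne: "q\<^sup>2 - q \<noteq> q\<^sup>2" "q\<^sup>2 \<noteq> 2" "q\<^sup>2 \<noteq> 0" "q\<^sup>2 - q \<noteq> 2" "q\<^sup>2 - q \<noteq> 0"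
      using q4 by auto
    have "{b. (if b = 1 then q\<^sup>2 else if b \<in> U then q\<^sup>2 - q
      else if b \<in> Lambda n then 2 else 0) = 2} = Lambda n"
      using ne L1 one_in_U by auto
    then have w2: "diff_w ?F 2 = q ^ 3 div 2 * (q - 1)"
      unfolding w by (simp only: card_Lambda)
    have "{b. (if b = 1 then q\<^sup>2 else if b \<in> U then q\<^sup>2 - q
      else if b \<in> Lambda n then 2 else 0) = q\<^sup>2 - q} = U - {1}"
      using ne by auto
    then have wqq: "diff_w ?F (q\<^sup>2 - q) = q"
      unfolding w by (simp only: card_U_Diff_one)
    have wi: "diff_w ?F i = 0" if "i \<notin> {0, 2, q\<^sup>2, q\<^sup>2 - q}" for i
    proof -
      have "{b. (if b = 1 then q\<^sup>2 else if b \<in> U then q\<^sup>2 - q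
        else if b \<in> Lambda n then 2 else 0) = i} = {}"
        using that by auto
      then show ?thesis
        unfolding w by (simp only: card.empty)
    qed
    have "even q"
      using n_pos by (simp add: q_eq)
    let ?I = "{0, 2, q\<^sup>2, q\<^sup>2 - q}" and ?J = "{i. even i \<and> i \<le> q\<^sup>2 \<and> i \<notin> {0, 2, q\<^sup>2, q\<^sup>2 - q}}"
    have "{i. even i \<and> i \<le> q\<^sup>2} = ?I \<union> ?J"
      using \<open>even q\<close> q2 q4 by auto
    then have "diff_spectrum ?F = (\<lambda>i. (i, diff_w ?F i)) ` ?I \<union> (\<lambda>i. (i, diff_w ?F i)) ` ?J"
      by (simp only: spec image_Un)
    also have "(\<lambda>i. (i, diff_w ?F i)) ` ?J = (\<lambda>i. (i, 0)) ` ?J"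
      using wi by (intro image_cong) auto
    also have "\<dots> = {(i, 0) | i. even i \<and> i \<le> q\<^sup>2 \<and> i \<notin> {0, 2, q\<^sup>2, q\<^sup>2 - q}}"
      by blast
    finally show ?thesis
      using False by (simp only: image_insert image_empty w0 w2 wq wqq if_False)
  qed
qed

end

theorem theorem1p2:
  fixes n q d :: nat
  assumes "n \<ge> 1"
    and "q = 2 ^ n"
    and "d = q ^ 3 + q ^ 2 + q - 1"
    and "CARD('a::{field,finite}) = q ^ 4"
  shows "(\<forall>b::'a.
            (b = 1 \<longrightarrow> card {x. x ^ d + (x + 1) ^ d = b} = q ^ 2) \<and>
            (b \<in> mu (q + 1) - {1} \<longrightarrow> card {x. x ^ d + (x + 1) ^ d = b} = q ^ 2 - q) \<and>
            (b \<in> Lambda n \<longrightarrow> card {x. x ^ d + (x + 1) ^ d = b} = 2) \<and>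
            (b \<noteq> 1 \<and> b \<notin> mu (q + 1) - {1} \<and> b \<notin> Lambda n \<longrightarrow>
               card {x. x ^ d + (x + 1) ^ d = b} = 0)) \<and>
         (n \<noteq> 1 \<longrightarrow>
            diff_spectrum (\<lambda>x::'a. x ^ d) =
              {(0, (q ^ 3 div 2 - 1) * (q + 1)), (2, q ^ 3 div 2 * (q - 1)),
               (q ^ 2, 1), (q ^ 2 - q, q)} \<union>
              {(i, 0) | i. even i \<and> i \<le> q ^ 2 \<and> i \<notin> {0, 2, q ^ 2, q ^ 2 - q}}) \<and>
         (n = 1 \<longrightarrow>
            diff_spectrum (\<lambda>x::'a. x ^ d) =
              {(0, (q ^ 3 div 2 - 1) * (q + 1)), (2, q ^ 3 div 2 * (q - 1) + q),
               (q ^ 2, 1)})"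
proof -
  interpret quartic_field n q "TYPE('a)"
    using assms by unfold_locales auto
  \<comment> \<open>\<open>card_solutions\<close> tests \<open>U\<close> before
    \<open>Lambda\<close>; disjointness turns its nested cases into independent ones.\<close>
  have "b \<notin> mu (q + 1)" "b \<noteq> 1" if "b \<in> Lambda n" for b :: 'a
    using that U_Int_Lambda one_in_U unfolding U_eq_mu by blast+
  then show ?thesis
    unfolding assms(3) expo_def[symmetric] using card_solutions[unfolded U_eq_mu] diff_spectrum_power_expo by simp
qed

end
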